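(* Let $f(t),g(t)\in\mathbb{C}[[t]]$ be a delta series and an invertible series respectively, let $r\ge 1$ be an integer, and put $A(t)=1/g(f^{-1}(t))$, $H(t)=f^{-1}(t)$, $\partial_y=\frac{\partial}{\partial y}$. The Legendre-Gould Hopper based Sheffer polynomials $p_n={}_{{}_{s}LeG^{(r)}}s_{n}(x,y,z)$ are quasi-monomial under the action of the multiplicative operator $$\hat M=\left(y+2D_x^{-1}\frac{\partial}{\partial y}+rz\frac{\partial^{r-1}}{\partial y^{r-1}}-\frac{g'(\partial_y)}{g(\partial_y)}\right)\frac{1}{f'(\partial_y)},$$ or equivalently $$\hat M=\left(y+2D_x^{-1}\frac{\partial}{\partial y}+rz\frac{\partial^{r-1}}{\partial y^{r-1}}\right)H'\!\left(H^{-1}(\partial_y)\right)+\frac{A'\!\left(H^{-1}(\partial_y)\right)}{A\!\left(H^{-1}(\partial_y)\right)},$$ and the derivative operator $$\hat P=f(\partial_y),\qquad\text{or equivalently}\qquad \hat P=H^{-1}(\partial_y).$$ That is, $\hat M\{p_n\}=p_{n+1}$ for all $n\ge0$ and $\hat P\{p_n\}=n\,p_{n-1}$ for all $n\ge 0$ (with the right side $0$ for $n=0$).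
   Context: A delta series is $f\in\mathbb{C}[[t]]$ with $f(0)=0$, $f'(0)\neq 0$; $f^{-1}$ and $H^{-1}$ denote compositional inverses. An invertible series is $g\in\mathbb{C}[[t]]$ with $g(0)\ne 0$. $C_0(x)=\sum_{k\ge 0}\frac{(-1)^k x^k}{(k!)^2}$. $D_x^{-1}h=\int_0^x h\,d\xi$ (integration in the variable $x$). All operators act on $\mathbb{C}[x,y,z]$; a formal power series in $\partial_y$ acts termwise (locally finite sum). The Legendre-Gould Hopper based Sheffer polynomials are determined by the generating function $$\frac{1}{g(f^{-1}(t))}\,C_0\!\left(-x\,(f^{-1}(t))^2\right)\exp\!\left(y f^{-1}(t)+z\,(f^{-1}(t))^r\right)=\sum_{n=0}^{\infty}{}_{{}_{s}LeG^{(r)}}s_{n}(x,y,z)\frac{t^n}{n!}.$$ *)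

theory Defs
  imports "HOL-Computational_Algebra.Computational_Algebra"
begin

unbundle fps_syntax

definition delta_series :: "complex fps \<Rightarrow> bool" where
  "delta_series f \<longleftrightarrow> f $ 0 = 0 \<and> fps_deriv f $ 0 \<noteq> 0"

definition invertible_series :: "complex fps \<Rightarrow> bool" where
  "invertible_series g \<longleftrightarrow> g $ 0 \<noteq> 0"

(* The ring C[x,y,z] is rendered as C[x][z][y]: the outermost indeterminate is y,
   the middle one z, the innermost one x.  Thus pderiv is the partial derivative
   with respect to y. *)
type_synonym xyz_poly = "complex poly poly poly"

definition varX :: xyz_poly where "varX = [:[:[:0, 1:]:]:]"
definition varY :: xyz_poly where "varY = [:0, 1:]"
definition varZ :: xyz_poly where "varZ = [:[:0, 1:]:]"

definition cst :: "complex \<Rightarrow> xyz_poly" where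
  "cst c = [:[:[:c:]:]:]"

(* The inclusion of C[[t]] into C[x,y,z][[t]]. *)
definition lift_fps :: "complex fps \<Rightarrow> xyz_poly fps" where
  "lift_fps F = Abs_fps (\<lambda>n. cst (F $ n))"

definition C0 :: "complex fps" where
  "C0 = Abs_fps (\<lambda>k. (-1) ^ k / (fact k)\<^sup>2)"

(* In the generating function t is the fps variable, and C0 and exp are substituted
   (oo) with series in t over C[x,y,z] that have zero constant term. *)
definition leG_sheffer_gf :: "complex fps \<Rightarrow> complex fps \<Rightarrow> nat \<Rightarrow> xyz_poly fps" where
  "leG_sheffer_gf f g r =
     (let H = lift_fps (fps_inv f) in
        lift_fps (1 / (g oo fps_inv f))
        * (lift_fps C0 oo (- (fps_const varX * H ^ 2)))
        * (lift_fps (fps_exp 1) oo (fps_const varY * H + fps_const varZ * H ^ r)))"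

definition leG_sheffer :: "complex fps \<Rightarrow> complex fps \<Rightarrow> nat \<Rightarrow> nat \<Rightarrow> xyz_poly" where
  "leG_sheffer f g r n = fact n * leG_sheffer_gf f g r $ n"

lemma cst_inverse_fact: "cst (1 / fact n) * fact n = 1"
proof -
  have "(fact n :: xyz_poly) = cst (fact n)"
    by (subst (1 2) of_nat_fact [symmetric]) (simp only: of_nat_poly cst_def)
  then show ?thesis by (simp add: cst_def one_pCons)
qed

lemma leG_sheffer_gf_eq:
  "leG_sheffer_gf f g r = Abs_fps (\<lambda>n. leG_sheffer f g r n * cst (1 / fact n))"
proof (rule fps_ext)
  fix n
  have "leG_sheffer f g r n * cst (1 / fact n) =
      leG_sheffer_gf f g r $ n * (cst (1 / fact n) * fact n)"
    by (simp only: leG_sheffer_def mult_ac)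
  then show "leG_sheffer_gf f g r $ n =
      Abs_fps (\<lambda>n. leG_sheffer f g r n * cst (1 / fact n)) $ n"
    by (simp add: cst_inverse_fact)
qed

definition dy :: "xyz_poly \<Rightarrow> xyz_poly" where
  "dy = pderiv"

(* Integration from 0 to the indeterminate of a univariate polynomial. *)
definition poly_int0 :: "complex poly \<Rightarrow> complex poly" where
  "poly_int0 q = (\<Sum>k\<le>degree q. monom (coeff q k / of_nat (k + 1)) (k + 1))"

lemma poly_int0_0 [simp]: "poly_int0 0 = 0"
  by (simp add: poly_int0_def)

lemma pderiv_poly_int0: "pderiv (poly_int0 q) = q"
proof -
  have "pderiv (poly_int0 q) = (\<Sum>k\<le>degree q. monom (coeff q k) k)"
    unfolding poly_int0_def by (simp add: higher_pderiv_sum [of 1, simplified] pderiv_monom del: of_nat_Suc)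
  then show ?thesis by (simp add: poly_as_sum_of_monoms)
qed

lemma poly_poly_int0_0: "poly (poly_int0 q) 0 = 0"
  by (simp add: poly_int0_def poly_sum poly_monom)

definition Dx_inv :: "xyz_poly \<Rightarrow> xyz_poly" where
  "Dx_inv = map_poly (map_poly poly_int0)"

(* The operator F(d/dy); all terms with k above the y-degree of p vanish. *)
definition fps_dy :: "complex fps \<Rightarrow> xyz_poly \<Rightarrow> xyz_poly" where
  "fps_dy F p = (\<Sum>k\<le>degree p. cst (F $ k) * (dy ^^ k) p)"

lemma fps_dy_altdef:
  assumes "degree p \<le> N"
  shows "fps_dy F p = (\<Sum>k\<le>N. cst (F $ k) * (dy ^^ k) p)"
  unfolding fps_dy_def
proof (rule sum.mono_neutral_left)
  show "\<forall>k\<in>{..N} - {..degree p}. cst (F $ k) * (dy ^^ k) p = 0"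
  proof
    fix k assume "k \<in> {..N} - {..degree p}"
    then have "degree p < k" by simp
    then have "(pderiv ^^ k) p = 0"
      by (intro poly_eqI) (simp add: coeff_higher_pderiv coeff_eq_0)
    then show "cst (F $ k) * (dy ^^ k) p = 0"
      by (simp add: dy_def)
  qed
qed (use assms in auto)

definition mult_op_core :: "nat \<Rightarrow> xyz_poly \<Rightarrow> xyz_poly" where
  "mult_op_core r p =
     varY * p + 2 * Dx_inv (dy p) + of_nat r * varZ * (dy ^^ (r - 1)) p"

definition mult_op :: "complex fps \<Rightarrow> complex fps \<Rightarrow> nat \<Rightarrow> xyz_poly \<Rightarrow> xyz_poly" where
  "mult_op f g r p =
     (let q = fps_dy (1 / fps_deriv f) p
      in mult_op_core r q - fps_dy (fps_deriv g / g) q)"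

definition mult_op' :: "complex fps \<Rightarrow> complex fps \<Rightarrow> nat \<Rightarrow> xyz_poly \<Rightarrow> xyz_poly" where
  "mult_op' A H r p =
     mult_op_core r (fps_dy (fps_deriv H oo fps_inv H) p)
     + fps_dy ((fps_deriv A oo fps_inv H) / (A oo fps_inv H)) p"

definition deriv_op :: "complex fps \<Rightarrow> xyz_poly \<Rightarrow> xyz_poly" where
  "deriv_op f = fps_dy f"

definition deriv_op' :: "complex fps \<Rightarrow> xyz_poly \<Rightarrow> xyz_poly" where
  "deriv_op' H = fps_dy (fps_inv H)"

definition quasi_monomial ::
  "(xyz_poly \<Rightarrow> xyz_poly) \<Rightarrow> (xyz_poly \<Rightarrow> xyz_poly) \<Rightarrow> (nat \<Rightarrow> xyz_poly) \<Rightarrow> bool" where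
  "quasi_monomial M P p \<longleftrightarrow>
     (\<forall>n. M (p n) = p (n + 1)) \<and> (\<forall>n. P (p n) = of_nat n * p (n - 1))"

end

theory Submission
  imports Defs
begin

text \<open>
  Put \<open>W(u) = C\<^sub>0(-x u\<^sup>2) exp(y u + z u\<^sup>r) = \<Sum> w\<^sub>k u\<^sup>k\<close>, so that the generating function is
  \<open>A(t) W(H(t))\<close>. Since \<open>\<partial>_y W = u W\<close> and \<open>(y + 2 D_x\<^sup>-\<^sup>1 \<partial>_y + r z \<partial>_y\<^sup>r\<^sup>-\<^sup>1) W = W'(u)\<close>, operators on
  the polynomials turn into operations on the prefactor of \<open>W(H(t))\<close>: a series \<open>F(\<partial>_y)\<close> maps
  \<open>B(t) W(H(t))\<close> to \<open>B(t) F(H(t)) W(H(t))\<close>, and the bracket maps \<open>A H' W(H)\<close> to \<open>A (W \<circ> H)'\<close>. With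
  \<open>f(H(t)) = t\<close> the operator \<open>P\<close> becomes multiplication by \<open>t\<close>, and \<open>M\<close> becomes \<open>d/dt\<close> by the
  product rule.
\<close>

section \<open>Constants and scalar power series inside the polynomial ring\<close>

lemma cst_0 [simp]: "cst 0 = 0" and cst_1 [simp]: "cst 1 = 1"
  and cst_add: "cst (a + b) = cst a + cst b"
  and cst_minus: "cst (- a) = - cst a"
  and cst_mult: "cst (a * b) = cst a * cst b"
  by (simp_all add: cst_def one_pCons)

lemma cst_of_nat: "cst (of_nat n) = of_nat n"
  by (simp add: cst_def of_nat_poly)

lemma cst_sum: "cst (sum a S) = (\<Sum>i\<in>S. cst (a i))"
  by (induction S rule: infinite_finite_induct) (simp_all add: cst_add)

lemma cst_mult_conv_smult: "cst c * p = smult [:[:c:]:] p"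
  by (simp add: cst_def)

lemma lift_fps_nth [simp]: "lift_fps F $ n = cst (F $ n)"
  by (simp add: lift_fps_def)

lemma lift_fps_add: "lift_fps (F + G) = lift_fps F + lift_fps G"
  by (simp add: fps_eq_iff cst_add)

lemma lift_fps_minus: "lift_fps (- F) = - lift_fps F"
  by (simp add: fps_eq_iff cst_minus)

lemma lift_fps_mult: "lift_fps (F * G) = lift_fps F * lift_fps G"
  by (simp add: fps_eq_iff fps_mult_nth cst_sum cst_mult)

lemma lift_fps_1: "lift_fps 1 = 1"
  by (simp add: fps_eq_iff)

lemma lift_fps_X: "lift_fps fps_X = fps_X"
  by (simp add: fps_eq_iff)

lemma lift_fps_power: "lift_fps (F ^ n) = lift_fps F ^ n"
  by (induction n) (simp_all add: lift_fps_1 lift_fps_mult)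

lemma lift_fps_deriv: "lift_fps (fps_deriv F) = fps_deriv (lift_fps F)"
  by (simp add: fps_eq_iff cst_mult cst_of_nat flip: of_nat_Suc)

section \<open>Derivations, their coefficientwise extension, and a chain rule\<close>

text \<open>One abstraction serves both partial derivatives: \<open>map_poly\<close> carries a
  derivation up the tower of polynomial rings, \<open>fps_map\<close> carries it on to power series,
  where it differentiates coefficients and leaves the series variable alone.\<close>

locale derivation =
  fixes D :: "'a::comm_ring_1 \<Rightarrow> 'a"
  assumes add: "D (a + b) = D a + D b"
    and mult: "D (a * b) = D a * b + a * D b"
begin

lemma zero [simp]: "D 0 = 0"
  using add [of 0 0] by simp

lemma one [simp]: "D 1 = 0"
  using mult [of 1 1] by simp

lemma minus: "D (- a) = - D a"
  using add [of a "- a"] by (simp add: eq_neg_iff_add_eq_0 add.commute)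

lemma sum: "D (sum a S) = (\<Sum>i\<in>S. D (a i))"
  by (induction S rule: infinite_finite_induct) (simp_all add: add)

lemma of_nat [simp]: "D (of_nat n) = 0"
  by (induction n) (simp_all add: add)

lemma power: "D (a ^ n) = of_nat n * a ^ (n - 1) * D a"
proof (induction n)
  case (Suc n)
  then show ?case
    by (cases n) (simp_all add: mult algebra_simps)
qed simp

lemma map_poly: "derivation (map_poly D)"
proof
  show "map_poly D (p + q) = map_poly D p + map_poly D q" for p q
    by (rule poly_eqI) (simp add: coeff_map_poly add)
  show "map_poly D (p * q) = map_poly D p * q + p * map_poly D q" for p q
    by (rule poly_eqI) (simp add: coeff_map_poly coeff_mult sum mult sum.distrib)
qed

definition fps_map :: "'a fps \<Rightarrow> 'a fps" where
  "fps_map F = Abs_fps (\<lambda>n. D (F $ n))"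

lemma fps_map_nth [simp]: "fps_map F $ n = D (F $ n)"
  by (simp add: fps_map_def)

lemma derivation_fps_map: "derivation fps_map"
proof
  show "fps_map (F + G) = fps_map F + fps_map G" for F G
    by (simp add: fps_eq_iff add)
  show "fps_map (F * G) = fps_map F * G + F * fps_map G" for F G
    by (simp add: fps_eq_iff fps_mult_nth sum mult sum.distrib)
qed

interpretation fps: derivation fps_map
  by (rule derivation_fps_map)

lemma fps_map_const [simp]: "fps_map (fps_const a) = fps_const (D a)"
  by (simp add: fps_eq_iff)

lemma fps_map_X [simp]: "fps_map fps_X = 0"
  by (simp add: fps_eq_iff)

text \<open>As the coefficients of \<open>F\<close> are constants for \<open>D\<close>, only the
  powers of \<open>a\<close> are differentiated, and the power rule applies term by term.\<close>

lemma fps_map_compose: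
  assumes F: "\<And>n. D (F $ n) = 0" and a: "a $ 0 = 0"
  shows "fps_map (F oo a) = (fps_deriv F oo a) * fps_map a"
proof (rule fps_ext)
  fix n
  have vanish: "a ^ i $ m = 0" if "m < i" for i m
    using startsby_zero_power_prefix [OF a] that by blast
  \<comment> \<open>A common cut-off \<open>N\<close> for all coefficients up to \<open>N\<close>
    makes the sums interchangeable later.\<close>
  have comp: "(G oo a) $ m = (\<Sum>i\<le>N. G $ i * a ^ i $ m)" if "m \<le> N" for G m N
    unfolding fps_compose_nth atMost_atLeast0 [symmetric]
    by (rule sum.mono_neutral_left) (use that vanish in auto)
  \<comment> \<open>The vanishing term \<open>Suc n\<close> is included so that the index shift
    after dropping \<open>i = 0\<close> ends at \<open>n\<close>.\<close>
  have "fps_map (F oo a) $ n = (\<Sum>i\<le>Suc n. F $ i * fps_map (a ^ i) $ n)"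
    by (simp add: comp [of n "Suc n"] sum mult F del: sum.atMost_Suc)
  also have "\<dots> = (\<Sum>i\<le>n. F $ Suc i * (of_nat (Suc i) * a ^ i * fps_map a) $ n)"
    by (simp add: sum.atMost_Suc_shift fps.power del: sum.atMost_Suc fps_map_nth of_nat_Suc)
  also have "\<dots> = (\<Sum>i\<le>n. fps_deriv F $ i * (a ^ i * fps_map a) $ n)"
    by (intro sum.cong refl)
      (simp only: mult.assoc fps_of_nat [symmetric] fps_mult_left_const_nth,
        simp add: mult_ac del: of_nat_Suc)
  also have "\<dots> = (\<Sum>i\<le>n. \<Sum>j\<le>n. fps_deriv F $ i * (a ^ i $ j * D (a $ (n - j))))"
    by (simp add: fps_mult_nth sum_distrib_left atMost_atLeast0 del: fps_deriv_nth)
  also have "\<dots> = (\<Sum>j\<le>n. (fps_deriv F oo a) $ j * D (a $ (n - j)))"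
    by (subst sum.swap)
      (simp add: comp [of _ n] sum_distrib_right mult.assoc del: fps_deriv_nth)
  also have "\<dots> = ((fps_deriv F oo a) * fps_map a) $ n"
    by (simp add: fps_mult_nth atMost_atLeast0)
  finally show "fps_map (F oo a) $ n = ((fps_deriv F oo a) * fps_map a) $ n" .
qed

end

section \<open>Partial derivatives and integration in x\<close>

definition dx :: "xyz_poly \<Rightarrow> xyz_poly" where
  "dx = map_poly (map_poly pderiv)"

lemma derivation_pderiv: "derivation (pderiv :: 'a::idom poly \<Rightarrow> 'a poly)"
  by standard (simp_all add: pderiv_add pderiv_mult algebra_simps)

interpretation dy: derivation dy
  unfolding dy_def by (rule derivation_pderiv)

interpretation dx: derivation dx
  unfolding dx_def by (intro derivation.map_poly derivation_pderiv)

lemma dy_cst [simp]: "dy (cst c) = 0" and dx_cst [simp]: "dx (cst c) = 0"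
  by (simp add: dy_def cst_def)
    (intro poly_eqI, simp add: dx_def cst_def coeff_map_poly coeff_pCons split: nat.split)

lemma dy_vars [simp]: "dy varX = 0" "dy varY = 1" "dy varZ = 0"
  by (simp_all add: dy_def varX_def varY_def varZ_def pderiv_pCons)

lemma dx_vars [simp]: "dx varX = 1" "dx varY = 0" "dx varZ = 0"
  by (intro poly_eqI; simp add: dx_def varX_def varY_def varZ_def coeff_map_poly coeff_pCons
      coeff_1 pderiv_pCons split: nat.split)+

lemma coeff_poly_int0:
  "coeff (poly_int0 q) n = (if n = 0 then 0 else coeff q (n - 1) / of_nat n)"
proof (cases n)
  case (Suc m)
  then show ?thesis
    by (cases "m \<le> degree q")
      (auto simp: poly_int0_def coeff_sum coeff_eq_0 simp del: of_nat_Suc)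
qed (simp add: poly_int0_def coeff_sum)

lemma coeff_Dx_inv: "coeff (coeff (Dx_inv p) i) j = poly_int0 (coeff (coeff p i) j)"
  by (simp add: Dx_inv_def coeff_map_poly)

lemma Dx_inv_0 [simp]: "Dx_inv 0 = 0"
  by (simp add: Dx_inv_def)

lemma Dx_inv_add: "Dx_inv (p + q) = Dx_inv p + Dx_inv q"
  by (intro poly_eqI) (simp add: coeff_Dx_inv coeff_poly_int0 add_divide_distrib)

lemma Dx_inv_cst_mult: "Dx_inv (cst c * p) = cst c * Dx_inv p"
  by (intro poly_eqI) (simp add: coeff_Dx_inv coeff_poly_int0 cst_mult_conv_smult)

text \<open>Integration from 0 undoes \<open>dx\<close> only on polynomials vanishing at x = 0,
  which the factor \<open>varX\<close> ensures.\<close>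

lemma Dx_inv_dx_varX_mult: "Dx_inv (dx (varX * p)) = varX * p"
  by (intro poly_eqI)
    (simp add: coeff_Dx_inv coeff_poly_int0 dx_def varX_def coeff_map_poly coeff_pderiv
      coeff_pCons split: nat.split)

section \<open>The kernel W(u) and the action of the operators on its coefficients\<close>

text \<open>This Bessel-type equation is the recursion (n+1)^2 c_(n+1) = -c_n of the
  coefficients.\<close>

lemma fps_deriv_C0: "fps_X * fps_deriv (fps_deriv C0) + fps_deriv C0 = - C0"
proof (rule fps_ext)
  fix n :: nat
  have "of_nat (Suc n) * (of_nat (Suc n) * C0 $ Suc n) = - C0 $ n"
    by (simp add: C0_def divide_simps power2_eq_square mult_ac del: of_nat_Suc)
  then show "(fps_X * fps_deriv (fps_deriv C0) + fps_deriv C0) $ n = (- C0) $ n"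
    by (cases n) (simp_all add: algebra_simps)
qed

definition leG_kernel :: "nat \<Rightarrow> xyz_poly fps" where
  "leG_kernel r = (lift_fps C0 oo (- (fps_const varX * fps_X ^ 2)))
     * (lift_fps (fps_exp 1) oo (fps_const varY * fps_X + fps_const varZ * fps_X ^ r))"

context
  fixes r :: nat
  assumes r: "r \<ge> 1"
begin

abbreviation (input) "CC F \<equiv> lift_fps F oo (- (fps_const varX * fps_X ^ 2))"
abbreviation (input) "EE \<equiv>
  lift_fps (fps_exp 1) oo (fps_const varY * fps_X + fps_const varZ * fps_X ^ r)"

lemma fps_deriv_lift_exp: "fps_deriv (lift_fps (fps_exp 1)) = lift_fps (fps_exp 1)"
  by (simp flip: lift_fps_deriv)

text \<open>The variable y enters only through the exponent, whose y-derivative is u;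
  \<open>r\<close> gives that exponent zero constant term.\<close>

lemma fps_map_dy_leG_kernel: "dy.fps_map (leG_kernel r) = fps_X * leG_kernel r"
proof -
  interpret D: derivation dy.fps_map by (rule dy.derivation_fps_map)
  have "dy.fps_map (CC C0) = 0"
    by (subst dy.fps_map_compose) (simp_all add: D.minus D.mult D.power)
  moreover have "dy.fps_map EE = EE * fps_X"
    using r by (subst dy.fps_map_compose)
      (simp_all add: D.add D.mult D.power fps_deriv_lift_exp)
  ultimately show ?thesis
    by (simp add: leG_kernel_def D.mult)
qed

lemma higher_dy_leG_kernel:
  "(dy ^^ j) (leG_kernel r $ k) = (if j \<le> k then leG_kernel r $ (k - j) else 0)"
proof (induction j)
  case (Suc j)
  have "dy (leG_kernel r $ m) = (if m = 0 then 0 else leG_kernel r $ (m - 1))" for m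
    using arg_cong [OF fps_map_dy_leG_kernel, of "\<lambda>F. F $ m"] by simp
  with Suc show ?case by auto
qed simp

text \<open>The product rule splits W'(u) into a \<open>C0\<close> part, a y part and a z part,
  which are matched with the three terms of \<open>mult_op_core\<close>.\<close>

lemma mult_op_core_leG_kernel:
  "mult_op_core r (leG_kernel r $ k) = of_nat (Suc k) * leG_kernel r $ Suc k"
proof -
  interpret D: derivation dx.fps_map by (rule dx.derivation_fps_map)
  \<comment> \<open>\<^term>\<open>fps_const varX * T\<close> is the part of the derivative coming from \<^const>\<open>C0\<close>. It is
    identified with the term of \<open>2 D_x\<^sup>-\<^sup>1 \<partial>_y\<close> by differentiating in \<open>x\<close>, and the differential equation
    of \<^const>\<open>C0\<close> enters there.\<close>
  define T where "T = - (2 * fps_X * CC (fps_deriv C0) * EE)"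
  have dx_E: "dx.fps_map EE = 0"
    using r by (subst dx.fps_map_compose) (simp_all add: D.add D.mult D.power)
  have dC: "fps_deriv (CC C0) = - (2 * fps_const varX * fps_X * CC (fps_deriv C0))"
    by (subst fps_compose_deriv) (simp_all add: lift_fps_deriv fps_deriv_power algebra_simps)
  have dxC: "dx.fps_map (CC F) = - (CC (fps_deriv F) * fps_X ^ 2)" for F
    by (subst dx.fps_map_compose) (simp_all add: lift_fps_deriv D.minus D.mult D.power)
  have dE: "fps_deriv EE = EE * (fps_const varY + of_nat r * fps_const varZ * fps_X ^ (r - 1))"
    using r by (subst fps_compose_deriv)
      (simp_all add: fps_deriv_lift_exp fps_deriv_power fps_of_nat algebra_simps)
  have deriv: "fps_deriv (leG_kernel r) = fps_const varX * T
      + fps_const varY * leG_kernel r + of_nat r * fps_const varZ * (fps_X ^ (r - 1) * leG_kernel r)"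
    unfolding leG_kernel_def fps_deriv_mult dC dE by (simp add: T_def algebra_simps)
  have CC_ode: "- (fps_const varX * fps_X ^ 2) * CC (fps_deriv (fps_deriv C0)) + CC (fps_deriv C0)
      = - CC C0"
  proof -
    have "CC (fps_X * fps_deriv (fps_deriv C0) + fps_deriv C0) = CC (- C0)"
      by (simp only: fps_deriv_C0)
    then show ?thesis
      by (simp add: lift_fps_add lift_fps_mult lift_fps_minus lift_fps_X fps_compose_add_distrib
        fps_compose_mult_distrib fps_compose_uminus)
  qed
  have dxT: "dx.fps_map (fps_const varX * T) = 2 * (fps_X * leG_kernel r)"
  proof -
    have "dx.fps_map T = 2 * fps_X * fps_X ^ 2 * CC (fps_deriv (fps_deriv C0)) * EE"
      using D.of_nat [of 2] by (simp add: T_def D.minus D.mult dx_E dxC)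
    then have "dx.fps_map (fps_const varX * T) = - (2 * fps_X * EE)
        * (- (fps_const varX * fps_X ^ 2) * CC (fps_deriv (fps_deriv C0)) + CC (fps_deriv C0))"
      by (simp add: D.mult) (simp add: T_def algebra_simps)
    also have "\<dots> = 2 * (fps_X * leG_kernel r)"
      by (simp only: CC_ode) (simp add: leG_kernel_def)
    finally show ?thesis .
  qed
  have two: "2 * p = cst 2 * p" for p
    using cst_of_nat [of 2] by simp
  have "2 * Dx_inv (dy (leG_kernel r $ k)) = Dx_inv (2 * dy (leG_kernel r $ k))"
    by (simp only: two Dx_inv_cst_mult)
  also have "2 * dy (leG_kernel r $ k) = dx (varX * T $ k)"
    using arg_cong [OF dxT, of "\<lambda>F. F $ k"] arg_cong [OF fps_map_dy_leG_kernel, of "\<lambda>F. F $ k"]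
    by (simp add: fps_numeral_fps_const)
  also have "Dx_inv \<dots> = varX * T $ k"
    by (rule Dx_inv_dx_varX_mult)
  finally have T: "2 * Dx_inv (dy (leG_kernel r $ k)) = varX * T $ k" .
  \<comment> \<open>Multiplication by u^(r-1) lowers the index by r-1, as does the (r-1)-fold
    y-derivative.\<close>
  have "(of_nat r * fps_const varZ * (fps_X ^ (r - 1) * leG_kernel r)) $ k
      = of_nat r * varZ * (dy ^^ (r - 1)) (leG_kernel r $ k)"
    by (simp add: higher_dy_leG_kernel mult.assoc fps_X_power_mult_nth flip: fps_of_nat)
  then show ?thesis
    using arg_cong [OF deriv, of "\<lambda>F. F $ k"]
    by (auto simp: mult_op_core_def T algebra_simps simp del: of_nat_Suc)
qed

end

section \<open>Algebra of the operators F(d/dy) and linearity of the bracket\<close>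

text \<open>Cutting off where the derivatives vanish avoids computing y-degrees, notably for the
  kernel coefficients.\<close>

lemma fps_dy_eq_sum:
  assumes "\<And>k. k > N \<Longrightarrow> (dy ^^ k) p = 0"
  shows "fps_dy F p = (\<Sum>k\<le>N. cst (F $ k) * (dy ^^ k) p)"
proof -
  have "fps_dy F p = (\<Sum>k\<le>max N (degree p). cst (F $ k) * (dy ^^ k) p)"
    by (rule fps_dy_altdef) simp
  also have "\<dots> = (\<Sum>k\<le>N. cst (F $ k) * (dy ^^ k) p)"
    by (rule sum.mono_neutral_right) (use assms in auto)
  finally show ?thesis .
qed

lemma higher_dy_eq_0: "degree p < k \<Longrightarrow> (dy ^^ k) p = 0"
  unfolding dy_def by (intro poly_eqI) (simp add: coeff_higher_pderiv coeff_eq_0)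

lemma higher_dy_add: "(dy ^^ k) (p + q) = (dy ^^ k) p + (dy ^^ k) q"
  by (simp add: dy_def higher_pderiv_add)

lemma higher_dy_sum: "(dy ^^ k) (sum p S) = (\<Sum>i\<in>S. (dy ^^ k) (p i))"
  by (simp add: dy_def higher_pderiv_sum)

lemma higher_dy_cst_mult: "(dy ^^ k) (cst c * p) = cst c * (dy ^^ k) p"
  by (simp add: dy_def cst_mult_conv_smult higher_pderiv_smult)

lemma fps_dy_cst_mult: "fps_dy F (cst c * p) = cst c * fps_dy F p"
proof -
  have 0: "(dy ^^ k) (cst c * p) = 0" if "k > degree p" for k
    using that by (simp add: higher_dy_cst_mult higher_dy_eq_0)
  have "fps_dy F (cst c * p) = (\<Sum>k\<le>degree p. cst (F $ k) * (dy ^^ k) (cst c * p))"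
    by (rule fps_dy_eq_sum [OF 0])
  then show ?thesis
    by (simp add: fps_dy_def higher_dy_cst_mult sum_distrib_left mult.left_commute)
qed

lemma fps_dy_minus: "fps_dy (- F) p = - fps_dy F p"
  by (simp add: fps_dy_def cst_minus sum_negf)

lemma fps_dy_mult: "fps_dy (F * G) p = fps_dy F (fps_dy G p)"
proof -
  define N where "N = degree p"
  have 0: "(dy ^^ k) p = 0" if "k > N" for k
    using that by (simp add: N_def higher_dy_eq_0)
  have G: "(dy ^^ j) (fps_dy G p) = (\<Sum>k\<le>N. cst (G $ k) * (dy ^^ (j + k)) p)" for j
    by (simp add: fps_dy_eq_sum [OF 0] higher_dy_sum higher_dy_cst_mult funpow_add)
  have "fps_dy F (fps_dy G p) = (\<Sum>j\<le>N. cst (F $ j) * (dy ^^ j) (fps_dy G p))"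
    by (rule fps_dy_eq_sum) (simp add: G 0)
  also have "\<dots> = (\<Sum>j\<le>N. \<Sum>k\<le>N. cst (F $ j * G $ k) * (dy ^^ (j + k)) p)"
    by (simp add: G sum_distrib_left cst_mult mult.assoc)
  also have "\<dots> = (\<Sum>(j, k)\<in>{..N} \<times> {..N}. cst (F $ j * G $ k) * (dy ^^ (j + k)) p)"
    by (simp add: sum.cartesian_product)
  \<comment> \<open>Pairs with \<open>j + k > N\<close> involve vanishing derivatives; the remaining
    triangle is summed as a Cauchy product.\<close>
  also have "\<dots> = (\<Sum>(j, k)\<in>{(j, k). j + k \<le> N}. cst (F $ j * G $ k) * (dy ^^ (j + k)) p)"
    by (rule sum.mono_neutral_right) (auto, metis 0 linorder_not_le)
  also have "\<dots> = (\<Sum>n\<le>N. \<Sum>j\<le>n. cst (F $ j * G $ (n - j)) * (dy ^^ n) p)"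
    by (simp add: sum.triangle_reindex_eq)
  also have "\<dots> = fps_dy (F * G) p"
    by (simp add: fps_dy_eq_sum [OF 0] fps_mult_nth cst_sum sum_distrib_right atMost_atLeast0)
  finally show ?thesis ..
qed

lemma fps_dy_add: "fps_dy F (p + q) = fps_dy F p + fps_dy F q"
proof -
  have "fps_dy F (p + q) = (\<Sum>k\<le>max (degree p) (degree q). cst (F $ k) * (dy ^^ k) (p + q))"
    by (rule fps_dy_eq_sum) (simp add: higher_dy_add higher_dy_eq_0)
  then show ?thesis
    by (simp add: higher_dy_add fps_dy_altdef [of p "max (degree p) (degree q)"]
      fps_dy_altdef [of q "max (degree p) (degree q)"] distrib_left sum.distrib)
qed

lemma fps_dy_0 [simp]: "fps_dy F 0 = 0"
  by (simp add: fps_dy_def)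

lemma fps_dy_sum: "fps_dy F (sum p S) = (\<Sum>i\<in>S. fps_dy F (p i))"
  by (induction S rule: infinite_finite_induct) (simp_all add: fps_dy_add)

lemma mult_op_core_0 [simp]: "mult_op_core r 0 = 0"
  using higher_dy_cst_mult [of "r - 1" 0 0] by (simp add: mult_op_core_def)

lemma mult_op_core_add: "mult_op_core r (p + q) = mult_op_core r p + mult_op_core r q"
  by (simp add: mult_op_core_def higher_dy_add dy.add Dx_inv_add algebra_simps)

lemma mult_op_core_cst_mult: "mult_op_core r (cst c * p) = cst c * mult_op_core r p"
  by (simp add: mult_op_core_def higher_dy_cst_mult dy.mult Dx_inv_cst_mult)
    (simp add: algebra_simps)

lemma mult_op_core_sum: "mult_op_core r (sum p S) = (\<Sum>i\<in>S. mult_op_core r (p i))"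
  by (induction S rule: infinite_finite_induct) (simp_all add: mult_op_core_add)

section \<open>Coefficients of B(t) W(H(t))\<close>

text \<open>The coefficient of \<open>t\<^sup>n\<close> in \<open>B(t) W(H(t))\<close>; the terms with \<open>k > n\<close> vanish when \<open>H(0) = 0\<close>.\<close>
definition leG_coeff :: "complex fps \<Rightarrow> nat \<Rightarrow> complex fps \<Rightarrow> nat \<Rightarrow> xyz_poly" where
  "leG_coeff H r B n = (\<Sum>k\<le>n. cst ((B * H ^ k) $ n) * leG_kernel r $ k)"

lemma fps_mult_power_nth_0:
  fixes B H :: "'a::comm_ring_1 fps"
  assumes "H $ 0 = 0" "n < k"
  shows "(B * H ^ k) $ n = 0"
  using startsby_zero_power_prefix [OF assms(1), of k] assms(2) by (simp add: fps_mult_nth)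

lemma leG_coeff_eq_sum:
  assumes "H $ 0 = 0" "n \<le> N"
  shows "leG_coeff H r B n = (\<Sum>k\<le>N. cst ((B * H ^ k) $ n) * leG_kernel r $ k)"
  unfolding leG_coeff_def
  by (rule sum.mono_neutral_left) (use assms in \<open>auto simp: fps_mult_power_nth_0\<close>)

lemma leG_sheffer_eq_leG_coeff:
  assumes f: "delta_series f" and r: "r \<ge> 1"
  shows "leG_sheffer f g r n = fact n * leG_coeff (fps_inv f) r (1 / (g oo fps_inv f)) n"
proof -
  define H where "H = fps_inv f"
  have H0: "lift_fps H $ 0 = 0" by (simp add: H_def fps_inv_def)
  \<comment> \<open>Associativity moves the substitution of \<open>H\<close> inside both factors of
    the kernel.\<close>
  have sub: "lift_fps F oo a oo lift_fps H = lift_fps F oo (a oo lift_fps H)" if "a $ 0 = 0" for F a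
    using H0 that by (simp add: fps_compose_assoc)
  have "leG_sheffer_gf f g r = lift_fps (1 / (g oo H)) * (leG_kernel r oo lift_fps H)"
    using H0 r by (simp add: leG_sheffer_gf_def Let_def leG_kernel_def H_def [symmetric]
      fps_compose_mult_distrib sub fps_compose_uminus fps_compose_add_distrib
      fps_X_power_compose mult.assoc)
  moreover have "(lift_fps B * (leG_kernel r oo lift_fps H)) $ n = leG_coeff H r B n" for B
  proof -
    have "(leG_kernel r oo lift_fps H) $ m = (\<Sum>k\<le>n. leG_kernel r $ k * lift_fps (H ^ k) $ m)"
      if "m \<le> n" for m
      unfolding fps_compose_nth atMost_atLeast0 [symmetric] lift_fps_power [symmetric]
      by (rule sum.mono_neutral_left)
        (use that fps_mult_power_nth_0 [of H _ _ 1] H0 in \<open>auto simp: H_def fps_inv_def\<close>)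
    then have "(lift_fps B * (leG_kernel r oo lift_fps H)) $ n
        = (\<Sum>m\<le>n. \<Sum>k\<le>n. cst (B $ m * (H ^ k) $ (n - m)) * leG_kernel r $ k)"
      by (simp add: fps_mult_nth atMost_atLeast0 sum_distrib_left cst_mult mult_ac)
    also have "\<dots> = leG_coeff H r B n"
      unfolding leG_coeff_def
      by (subst sum.swap)
        (simp add: fps_mult_nth atMost_atLeast0 sum_distrib_right cst_sum)
    finally show ?thesis .
  qed
  ultimately show ?thesis
    by (simp add: leG_sheffer_def H_def)
qed

lemma fps_dy_leG_kernel:
  assumes "r \<ge> 1"
  shows "fps_dy F (leG_kernel r $ k) = (\<Sum>j\<le>k. cst (F $ j) * leG_kernel r $ (k - j))"
  using assms by (subst fps_dy_eq_sum [where N = k]) (simp_all add: higher_dy_leG_kernel)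

text \<open>Each \<open>F $ j\<close> lowers the kernel index by \<open>j\<close> while the power of
  \<open>H\<close> stays, so putting \<open>k = j + m\<close> leaves \<open>H ^ j\<close> over and
  these assemble to \<open>F oo H\<close>.\<close>

lemma fps_dy_leG_coeff:
  assumes H: "H $ 0 = 0" and r: "r \<ge> 1"
  shows "fps_dy F (leG_coeff H r B n) = leG_coeff H r (B * (F oo H)) n"
proof -
  have *: "(B * (F oo H) * H ^ m) $ n = (\<Sum>j\<le>n - m. F $ j * (B * H ^ (j + m)) $ n)"
    if "m \<le> n" for m
  proof -
    have "(B * (F oo H) * H ^ m) $ n = (\<Sum>i\<le>n. (B * H ^ m) $ (n - i) * (F oo H) $ i)"
    proof -
      have "B * (F oo H) * H ^ m = (F oo H) * (B * H ^ m)"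
        by (simp add: mult_ac)
      then show ?thesis
        by (simp only: fps_mult_nth [of "F oo H"] atMost_atLeast0 mult.commute)
    qed
    also have "\<dots> = (\<Sum>i\<le>n. \<Sum>j\<le>n. F $ j * ((H ^ j) $ i * (B * H ^ m) $ (n - i)))"
    proof (intro sum.cong refl)
      fix i assume "i \<in> {..n}"
      then have "(F oo H) $ i = (\<Sum>j\<le>n. F $ j * (H ^ j) $ i)"
        unfolding fps_compose_nth atMost_atLeast0 [symmetric]
        by (intro sum.mono_neutral_left) (use fps_mult_power_nth_0 [OF H, of _ _ 1] in auto)
      then show "(B * H ^ m) $ (n - i) * (F oo H) $ i
          = (\<Sum>j\<le>n. F $ j * ((H ^ j) $ i * (B * H ^ m) $ (n - i)))"
        by (simp add: sum_distrib_left mult_ac)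
    qed
    also have "\<dots> = (\<Sum>j\<le>n. F $ j * (H ^ j * (B * H ^ m)) $ n)"
      by (subst sum.swap) (simp add: fps_mult_nth [of "H ^ _"] atMost_atLeast0 sum_distrib_left)
    also have "\<dots> = (\<Sum>j\<le>n. F $ j * (B * H ^ (j + m)) $ n)"
      by (simp add: power_add mult_ac)
    also have "\<dots> = (\<Sum>j\<le>n - m. F $ j * (B * H ^ (j + m)) $ n)"
      by (rule sum.mono_neutral_right) (auto simp: fps_mult_power_nth_0 [OF H])
    finally show ?thesis .
  qed
  have "fps_dy F (leG_coeff H r B n)
      = (\<Sum>k\<le>n. \<Sum>j\<le>k. cst (F $ j * (B * H ^ k) $ n) * leG_kernel r $ (k - j))"
    by (simp add: leG_coeff_def fps_dy_sum fps_dy_cst_mult fps_dy_leG_kernel [OF r]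
      sum_distrib_left cst_mult mult.assoc mult.left_commute)
  also have "\<dots> = (\<Sum>(m, j)\<in>{(m, j). m + j \<le> n}.
      cst (F $ j * (B * H ^ (j + m)) $ n) * leG_kernel r $ m)"
    \<comment> \<open>The triangle is enumerated by \<open>m\<close>, the original inner sum by
      \<open>k - m\<close>; reversing the inner sum reconciles them.\<close>
    by (subst sum.triangle_reindex_eq, subst sum.atLeastAtMost_rev [where n = 0, folded atMost_atLeast0])
      (simp add: atMost_atLeast0)
  also have "\<dots> = (\<Sum>m\<le>n. \<Sum>j\<le>n - m.
      cst (F $ j * (B * H ^ (j + m)) $ n) * leG_kernel r $ m)"
    by (subst sum.Sigma) (auto intro!: sum.cong)
  also have "\<dots> = leG_coeff H r (B * (F oo H)) n"
    unfolding leG_coeff_def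
    by (intro sum.cong refl) (simp add: * cst_sum sum_distrib_right)
  finally show ?thesis .
qed

text \<open>The two summands are the coefficients of A (W(H))' and A' W(H), so together they give
  the derivative of A W(H).\<close>

lemma mult_op_core_leG_coeff:
  assumes H: "H $ 0 = 0" and r: "r \<ge> 1"
  shows "mult_op_core r (leG_coeff H r (A * fps_deriv H) n) + leG_coeff H r (fps_deriv A) n
    = of_nat (Suc n) * leG_coeff H r A (Suc n)"
proof -
  define a where "a k = cst ((fps_deriv A * H ^ k) $ n) * leG_kernel r $ k" for k
  define b where "b k = cst ((A * fps_deriv (H ^ k)) $ n) * leG_kernel r $ k" for k
  have "mult_op_core r (leG_coeff H r (A * fps_deriv H) n) = (\<Sum>k\<le>n. b (Suc k))"
    by (simp add: leG_coeff_def mult_op_core_sum mult_op_core_cst_mult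
        mult_op_core_leG_kernel [OF r] b_def fps_deriv_power del: of_nat_Suc power_Suc)
      (simp add: mult.left_commute [of _ "fps_const _"] mult.assoc cst_mult cst_of_nat
        mult.left_commute [of _ "of_nat _"] del: of_nat_Suc)
  \<comment> \<open>\<open>b 0\<close> vanishes because \<open>H ^ 0\<close> is constant.\<close>
  also have "\<dots> = (\<Sum>k\<le>Suc n. b k)"
    by (simp add: sum.atMost_Suc_shift b_def del: sum.atMost_Suc)
  moreover have "leG_coeff H r (fps_deriv A) n = (\<Sum>k\<le>Suc n. a k)"
    unfolding a_def by (rule leG_coeff_eq_sum [OF H]) simp
  moreover have "b k + a k = of_nat (Suc n) * (cst ((A * H ^ k) $ Suc n) * leG_kernel r $ k)" for k
  proof -
    have "b k + a k = cst (fps_deriv (A * H ^ k) $ n) * leG_kernel r $ k"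
      unfolding a_def b_def distrib_right [symmetric] cst_add [symmetric] fps_add_nth [symmetric]
      by simp
    then show ?thesis
      by (simp add: cst_mult cst_of_nat mult_ac del: of_nat_Suc fps_deriv_mult)
  qed
  ultimately show ?thesis
    by (simp add: leG_coeff_def sum_distrib_left flip: sum.distrib del: of_nat_Suc sum.atMost_Suc)
qed

section \<open>Equality of the two forms of the operators, and quasi-monomiality\<close>

theorem theorem2p3:
  fixes f g A H :: "complex fps" and r :: nat
  assumes "delta_series f" and "invertible_series g" and "r \<ge> 1"
    and "A = 1 / (g oo fps_inv f)" and "H = fps_inv f"
  shows "quasi_monomial (mult_op f g r) (deriv_op f) (leG_sheffer f g r)
    \<and> mult_op f g r = mult_op' A H r
    \<and> deriv_op f = deriv_op' H"
proof -
  from assms(1) have f: "f $ 0 = 0" "f $ 1 \<noteq> 0" "fps_deriv f $ 0 \<noteq> 0"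
    by (simp_all add: delta_series_def)
  from assms(2) have g: "g $ 0 \<noteq> 0"
    by (simp add: invertible_series_def)
  note r = assms(3) and H = assms(5)
  have A: "A = inverse (g oo H)"
    using g by (simp add: assms(4) H fps_divide_unit)
  have H0: "H $ 0 = 0"
    by (simp add: H fps_inv_def)
  have fH: "f oo H = fps_X"
    using fps_inv_right [OF f(1,2)] by (simp add: H)
  have Hf: "H oo f = fps_X"
    using fps_inv [OF f(1,2)] by (simp add: H)
  have inv_H: "fps_inv H = f"
    using fps_inv_idempotent [OF f(1,2)] by (simp add: H)
  have H': "1 / fps_deriv f oo H = fps_deriv H"
    using fps_inv_deriv [OF f(1,2)] f H0
    by (simp add: H fps_divide_compose fps_divide_unit fps_inverse_compose)
  have H'f: "fps_deriv H oo f = 1 / fps_deriv f"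
    by (simp add: fps_compose_assoc [OF f(1) H0, symmetric] Hf flip: H')
  \<comment> \<open>Logarithmic derivative of A = 1/g(H).\<close>
  have A': "fps_deriv A = - (A * fps_deriv H * (fps_deriv g / g oo H))"
    using g H0 by (simp add: A fps_inverse_deriv fps_compose_deriv fps_compose_mult_distrib
      fps_divide_unit fps_inverse_compose       power2_eq_square mult_ac)
  have A'f: "(fps_deriv A oo f) / (A oo f) = - (fps_deriv g / g * (1 / fps_deriv f))"
  proof -
    have nz: "(A oo f) $ 0 \<noteq> 0"
      using g by (simp add: A)
    have "fps_deriv A oo f = - (fps_deriv g / g * (1 / fps_deriv f)) * (A oo f)"
      by (simp add: A' fps_compose_uminus fps_compose_mult_distrib f H'f mult_ac
        fps_compose_assoc [OF f(1) H0, symmetric] Hf)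
    with nz show ?thesis
      by (simp add: fps_divide_unit mult.assoc inverse_mult_eq_1')
  qed
  \<comment> \<open>By \<open>fps_dy_mult\<close>, the product of g'/g and 1/f' acts as the
    composite of the two operators.\<close>
  have M_eq: "mult_op f g r = mult_op' A H r"
    by (rule ext) (simp add: mult_op_def mult_op'_def Let_def inv_H H'f A'f fps_dy_minus fps_dy_mult)
  have P_eq: "deriv_op f = deriv_op' H"
    by (simp add: deriv_op_def deriv_op'_def inv_H)
  \<comment> \<open>The factorial is written with \<open>cst\<close> so that the linearity lemmas
    apply.\<close>
  have s: "leG_sheffer f g r n = cst (fact n) * leG_coeff H r A n" for n
    using leG_sheffer_eq_leG_coeff [OF assms(1) r, of g n] cst_of_nat [of "fact n"]
    by (simp add: assms(4) H)
  have M: "mult_op f g r (leG_sheffer f g r n) = leG_sheffer f g r (n + 1)" for n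
  proof -
    have q: "fps_dy (1 / fps_deriv f) (leG_coeff H r A n) = leG_coeff H r (A * fps_deriv H) n"
      by (simp add: fps_dy_leG_coeff [OF H0 r] H')
    \<comment> \<open>The operator multiplies the prefactor A H' by -(g'/g)(H), which by the formula
      for A' yields A'.\<close>
    have "fps_dy (- (fps_deriv g / g)) (leG_coeff H r (A * fps_deriv H) n)
        = leG_coeff H r (fps_deriv A) n"
      by (simp only: fps_dy_leG_coeff [OF H0 r] A' fps_compose_uminus mult_minus_right)
    then have "leG_coeff H r (fps_deriv A) n
        = - fps_dy (fps_deriv g / g) (leG_coeff H r (A * fps_deriv H) n)"
      by (simp only: fps_dy_minus)
    then have "mult_op f g r (leG_sheffer f g r n) = cst (fact n) *
       (mult_op_core r (leG_coeff H r (A * fps_deriv H) n) + leG_coeff H r (fps_deriv A) n)"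
      by (simp add: mult_op_def Let_def s fps_dy_cst_mult mult_op_core_cst_mult q algebra_simps)
    also have "\<dots> = cst (fact n) * (of_nat (Suc n) * leG_coeff H r A (Suc n))"
      by (simp only: mult_op_core_leG_coeff [OF H0 r])
    also have "\<dots> = leG_sheffer f g r (n + 1)"
      by (simp add: s cst_mult mult_ac flip: cst_of_nat del: of_nat_Suc)
    finally show ?thesis .
  qed
  have P: "deriv_op f (leG_sheffer f g r n) = of_nat n * leG_sheffer f g r (n - 1)" for n
  proof -
    have "deriv_op f (leG_sheffer f g r n) = cst (fact n) * leG_coeff H r (A * fps_X) n"
      by (simp add: deriv_op_def s fps_dy_cst_mult fps_dy_leG_coeff [OF H0 r] fH)
    also have "\<dots> = of_nat n * leG_sheffer f g r (n - 1)"
    proof (cases n)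
      case (Suc m)
      \<comment> \<open>The factor t shifts each coefficient by one; the extra term
        \<open>k = Suc m\<close> on the right is zero.\<close>
      have "leG_coeff H r (A * fps_X) (Suc m) = leG_coeff H r A m"
        unfolding leG_coeff_eq_sum [OF H0, of m "Suc m", OF le_SucI [OF le_refl]]
          leG_coeff_def [of H r "A * fps_X"]
        by (simp add: mult.commute [of A] mult.assoc del: sum.atMost_Suc)
      with Suc show ?thesis
        by (simp add: s cst_mult mult_ac flip: cst_of_nat del: of_nat_Suc)
    \<comment> \<open>For \<open>n = 0\<close>, A(t) t has no constant term, and the factor 0 makes
      the truncated index \<open>n - 1\<close> harmless.\<close>
    qed (simp add: leG_coeff_def)
    finally show ?thesis .
  qed
  show ?thesis
    using M P M_eq P_eq by (simp add: quasi_monomial_def)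
qed

end
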